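(* Let $q=2$, let $s\geq 2$ be even, $n=\frac{2^{2s}-1}{3}$, and $2\le\delta\le n$. Let $\delta_{1,n}$ be the largest $2$-cyclotomic coset leader modulo $n$. Then $\mathcal{C}_{(2,n,\delta,2)}$ is a dually-BCH code if and only if $$\delta_{1,n}\leq\delta\leq n-1.$$
   Context: Let $\alpha$ be a generator of $\mathbb{F}_{2^{2s}}^*$ and $\beta_1=\alpha^{3}$, a primitive $n$-th root of unity. For an integer $j$ (read modulo $n$) let $m_j(x)$ be the minimal polynomial of $\beta_1^j$ over $\mathbb{F}_2$. For integers $b\ge 1$ and $2\le\delta\le n$, the BCH code $\mathcal{C}_{(2,n,\delta,b)}$ with respect to $\beta_1$ is the cyclic code of length $n$ over $\mathbb{F}_2$ (an ideal of $\mathbb{F}_2[x]/\langle x^n-1\rangle$) generated by $\mathrm{lcm}(m_b(x),m_{b+1}(x),\dots,m_{b+\delta-2}(x))$. A BCH code is called dually-BCH if its dual code (with respect to the standard inner product) is again a BCH code $\mathcal{C}_{(2,n,\delta',b')}$ with respect to the same primitive $n$-th root of unity, for some $b'$ and $\delta'$. The $2$-cyclotomic coset of $t$ modulo $n$ is $C_t=\{2^jt\bmod n: j\ge 0\}$; its smallest element is its coset leader. It is known that for even $s$, $\delta_{1,n}=\frac{2^{2s-1}-2^{s}-1}{3}$. *)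

theory Defs
  imports
    "HOL-Library.Z2"
    "HOL-Library.Cardinality"
    "HOL-Computational_Algebra.Computational_Algebra"
    "HOL-Computational_Algebra.Field_as_Ring"
begin

text \<open>
  The prime field is the type \<^typ>\<open>bit\<close>. The library does not provide gcds and lcms of polynomials
  over it; the following instances, made exactly as for \<^typ>\<open>rat\<close> and \<^typ>\<open>real\<close> in
  \<^theory>\<open>HOL-Computational_Algebra.Field_as_Ring\<close>, give \<^const>\<open>Lcm\<close> on \<^typ>\<open>bit poly\<close> its usual
  meaning (the monic least common multiple).
\<close>

instantiation bit ::
  "{unique_euclidean_ring, normalization_euclidean_semiring, normalization_semidom_multiplicative}"
begin

definition [simp]: "normalize_bit = (normalize_field :: bit \<Rightarrow> _)"
definition [simp]: "unit_factor_bit = (unit_factor_field :: bit \<Rightarrow> _)"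
definition [simp]: "euclidean_size_bit = (euclidean_size_field :: bit \<Rightarrow> _)"
definition [simp]: "division_segment (x :: bit) = 1"

instance
  by standard (auto simp: dvd_field_iff split: if_splits)

end

instantiation bit :: euclidean_ring_gcd
begin

definition gcd_bit :: "bit \<Rightarrow> bit \<Rightarrow> bit" where
  "gcd_bit = Euclidean_Algorithm.gcd"
definition lcm_bit :: "bit \<Rightarrow> bit \<Rightarrow> bit" where
  "lcm_bit = Euclidean_Algorithm.lcm"
definition Gcd_bit :: "bit set \<Rightarrow> bit" where
  "Gcd_bit = Euclidean_Algorithm.Gcd"
definition Lcm_bit :: "bit set \<Rightarrow> bit" where
  "Lcm_bit = Euclidean_Algorithm.Lcm"

instance
  by standard (simp_all add: gcd_bit_def lcm_bit_def Gcd_bit_def Lcm_bit_def)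

end

instance bit :: field_gcd ..


definition generates_units :: "'a :: field \<Rightarrow> bool" where
  "generates_units \<alpha> \<longleftrightarrow> range (\<lambda>k :: nat. \<alpha> ^ k) = UNIV - {0}"

text \<open>
  \<^term>\<open>of_bit :: bit \<Rightarrow> 'a :: field\<close> is a ring homomorphism, the embedding of the prime field,
  only if \<^typ>\<open>'a\<close> has characteristic 2; the definitions below are meant for such fields.
\<close>

definition poly_F2 :: "bit poly \<Rightarrow> 'a :: field \<Rightarrow> 'a" where
  "poly_F2 p x = poly (map_poly of_bit p) x"

definition min_poly :: "'a :: field \<Rightarrow> bit poly" where
  "min_poly x = (THE p. lead_coeff p = 1 \<and> poly_F2 p x = 0 \<and>
     (\<forall>q. q \<noteq> 0 \<longrightarrow> poly_F2 q x = 0 \<longrightarrow> degree p \<le> degree q))"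

text \<open>
  A word of length \<open>n\<close> is a polynomial of degree less than \<open>n\<close>, namely the canonical representative
  of a residue class modulo \<open>x ^ n - 1\<close>; its \<open>i\<close>-th letter is the \<open>i\<close>-th coefficient.
\<close>

definition cyclic_code :: "nat \<Rightarrow> bit poly \<Rightarrow> bit poly set" where
  "cyclic_code n g = range (\<lambda>f. (f * g) mod (monom 1 n - 1))"

definition dual_code :: "nat \<Rightarrow> bit poly set \<Rightarrow> bit poly set" where
  "dual_code n C =
     {u. degree u < n \<and> (\<forall>v \<in> C. (\<Sum>i<n. coeff u i * coeff v i) = 0)}"

definition bch_code :: "'a :: field \<Rightarrow> nat \<Rightarrow> nat \<Rightarrow> nat \<Rightarrow> bit poly set" where
  "bch_code \<beta> n \<delta> b = cyclic_code n (Lcm ((\<lambda>j. min_poly (\<beta> ^ j)) ` {b..b + \<delta> - 2}))"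

definition is_bch_code :: "'a :: field \<Rightarrow> nat \<Rightarrow> bit poly set \<Rightarrow> bool" where
  "is_bch_code \<beta> n C \<longleftrightarrow> (\<exists>\<delta> b. 1 \<le> b \<and> 2 \<le> \<delta> \<and> \<delta> \<le> n \<and> C = bch_code \<beta> n \<delta> b)"

definition dually_bch :: "'a :: field \<Rightarrow> nat \<Rightarrow> bit poly set \<Rightarrow> bool" where
  "dually_bch \<beta> n C \<longleftrightarrow> is_bch_code \<beta> n C \<and> is_bch_code \<beta> n (dual_code n C)"


definition cyclotomic_coset :: "nat \<Rightarrow> nat \<Rightarrow> nat set" where
  "cyclotomic_coset n t = {(2 ^ j * t) mod n | j. True}"

definition coset_leader :: "nat \<Rightarrow> nat \<Rightarrow> nat" where
  "coset_leader n t = Min (cyclotomic_coset n t)"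

definition largest_coset_leader :: "nat \<Rightarrow> nat" where
  "largest_coset_leader n = Max (coset_leader n ` {..<n})"

end

theory Submission
  imports Defs "HOL-Number_Theory.Cong"
begin

text \<open>
  A BCH code is determined by its set of zeros \<open>Z\<close> among the \<open>n\<close>-th roots of unity, which is closed
  under squaring; Fourier inversion and words of traces show that the dual code has the zeros
  \<open>x\<close> with \<open>1 / x \<notin> Z\<close>. In exponents modulo \<open>n\<close>: if the complement of \<open>- Z\<close> is the union of the
  cosets meeting an interval, this interval contains \<open>0\<close> but not \<open>- 1\<close>, hence is \<open>{0..c}\<close>, and every
  nonzero coset disjoint from \<open>Z\<close> meets \<open>{n - c..n - 1}\<close>, which lies above all of \<open>Z\<close>. For
  \<open>\<delta>\<close> smaller than the largest leader some coset violates this. Otherwise \<open>Z\<close> contains all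
  nonzero exponents, and the dual code has the single zero \<open>0\<close> if \<open>\<delta> < n\<close>, but no zero, unlike any
  BCH code, if \<open>\<delta> = n\<close>.
\<close>

section \<open>Cyclotomic cosets\<close>

text \<open>Closed under congruence instead of reduced modulo \<open>n\<close>, so that
  \<open>0\<close> and \<open>n\<close>, and intervals running past \<open>n\<close>, can be used as
  they are.\<close>

definition coset_union :: "nat \<Rightarrow> nat set \<Rightarrow> nat set" where
  "coset_union n J = {t. \<exists>j\<in>J. \<exists>i. [t = 2 ^ i * j] (mod n)}"

text \<open>The order of 2 modulo \<open>n\<close> divides \<open>m\<close>, so
  \<open>2 ^ (i * (m - 1))\<close> inverts \<open>2 ^ i\<close>. This makes lying in the same coset
  symmetric while all exponents stay natural numbers.\<close>

lemma inverse_power_of_two: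
  fixes n m i :: nat
  assumes "[2 ^ m = 1] (mod n)" "m > 0"
  obtains i' where "[2 ^ i' * 2 ^ i = 1] (mod n)"
proof
  have "i * (m - 1) + i = m * i" using assms(2) by (cases m) auto
  then have "(2::nat) ^ (i * (m - 1)) * 2 ^ i = (2 ^ m) ^ i"
    by (simp only: power_add[symmetric] power_mult[symmetric])
  then show "[2 ^ (i * (m - 1)) * 2 ^ i = 1] (mod n)"
    using cong_pow[OF assms(1), of i] by simp
qed

lemma coset_sym:
  fixes n m i t j :: nat
  assumes "[2 ^ m = 1] (mod n)" "m > 0" "[t = 2 ^ i * j] (mod n)"
  obtains i' where "[2 ^ i' * t = j] (mod n)"
proof -
  obtain i' where i': "[2 ^ i' * 2 ^ i = 1] (mod n)"
    using inverse_power_of_two assms by blast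
  have "[2 ^ i' * t = 2 ^ i' * (2 ^ i * j)] (mod n)"
    using assms(3) cong_scalar_left by blast
  moreover have "[2 ^ i' * 2 ^ i * j = 1 * j] (mod n)"
    using i' cong_scalar_right by blast
  ultimately have "[2 ^ i' * t = j] (mod n)"
    by (metis cong_trans mult.assoc mult_1)
  then show thesis by (rule that)
qed

text \<open>1 and 2 share a coset because \<open>2 ^ (m - 1) * 2\<close> is 1 modulo
  \<open>n\<close>. The offset 2 thus gives the zeros of a narrow-sense code.\<close>

lemma coset_union_from_1:
  fixes n m \<delta> :: nat
  assumes m: "[2 ^ m = 1] (mod n)" "m > 0" and \<delta>: "2 \<le> \<delta>"
  shows "coset_union n {2..\<delta>} = coset_union n {1..\<delta>}"
proof
  show "coset_union n {1..\<delta>} \<subseteq> coset_union n {2..\<delta>}"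
  proof
    fix t assume "t \<in> coset_union n {1..\<delta>}"
    then obtain j i where j: "j \<in> {1..\<delta>}" "[t = 2 ^ i * j] (mod n)"
      by (auto simp: coset_union_def)
    show "t \<in> coset_union n {2..\<delta>}"
    proof (cases "j = 1")
      case True
      have "2 ^ (i + (m - 1)) * 2 = 2 ^ i * (2::nat) ^ m"
        using m(2) by (cases m) (simp_all add: power_add)
      then have "[2 ^ i * 1 = 2 ^ (i + (m - 1)) * 2] (mod n)"
        using cong_scalar_left[OF m(1), of "2 ^ i"] by (simp add: cong_sym_eq)
      then have "[t = 2 ^ (i + (m - 1)) * 2] (mod n)"
        using j(2) True cong_trans by blast
      moreover have "2 \<in> {2..\<delta>}" using \<delta> by simp
      ultimately show ?thesis unfolding coset_union_def by blast
    next
      case False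
      then have "j \<in> {2..\<delta>}" using j(1) by auto
      then show ?thesis using j(2) unfolding coset_union_def by blast
    qed
  qed
qed (auto simp: coset_union_def)

text \<open>Modulo \<open>n\<close> the coset of 0 is 0 alone, and the interval lies strictly
  between 0 and \<open>n\<close>.\<close>

lemma multiple_notin_coset_union:
  fixes n m b \<delta> t :: nat
  assumes m: "[2 ^ m = 1] (mod n)" "m > 0" and "0 < b" "\<delta> < n" "n dvd t"
  shows "t \<notin> coset_union n {b..\<delta>}"
proof
  assume "t \<in> coset_union n {b..\<delta>}"
  then obtain j i where j: "j \<in> {b..\<delta>}" "[t = 2 ^ i * j] (mod n)"
    by (auto simp: coset_union_def)
  obtain i' where "[2 ^ i' * t = j] (mod n)" by (rule coset_sym[OF m j(2)])
  then have "n dvd j" using \<open>n dvd t\<close> by (meson cong_dvd_iff dvd_mult)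
  then show False using j(1) assms by (auto dest: dvd_imp_le)
qed

lemma mem_coset_unionI: "j \<in> J \<Longrightarrow> [t = 2 ^ i * j] (mod n) \<Longrightarrow> t \<in> coset_union n J"
  unfolding coset_union_def by blast

text \<open>
  If \<open>0\<close> but not \<open>- 1\<close> lies in the union of the cosets meeting an interval, the interval starts at \<open>0\<close>
  modulo \<open>n\<close>. As \<open>\<tau>\<close> is a zero, it stops before \<open>n - \<tau>\<close>, so that every coset of nonzeros other
  than \<open>{0}\<close> has to reach above \<open>\<tau>\<close>.
\<close>

lemma no_interval:
  fixes n m \<delta> b e \<tau> u :: nat
  assumes m: "[2 ^ m = 1] (mod n)" "m > 0"
    and \<delta>: "2 \<le> \<delta>" "\<delta> < n" and b: "1 \<le> b"
    and compl: "\<And>t. t \<le> n \<Longrightarrow> t \<in> coset_union n {b..e} \<longleftrightarrow> n - t \<notin> coset_union n {2..\<delta>}"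
    and \<tau>: "0 < \<tau>" "\<tau> < n" "\<tau> \<in> coset_union n {2..\<delta>}"
    and u: "u < n" "\<And>i. \<delta> < 2 ^ i * u mod n \<and> 2 ^ i * u mod n \<le> \<tau>"
  shows False
proof -
  have "n \<notin> coset_union n {2..\<delta>}"
    using \<delta> by (intro multiple_notin_coset_union[OF m]) auto
  then have "0 \<in> coset_union n {b..e}" using compl[of 0] by simp
  then obtain j0 i where j0: "j0 \<in> {b..e}" "[0 = 2 ^ i * j0] (mod n)"
    by (auto simp: coset_union_def)
  obtain i' where "[2 ^ i' * 0 = j0] (mod n)" by (rule coset_sym[OF m j0(2)])
  then have nj0: "n dvd j0" by (simp add: cong_def mod_eq_0_iff_dvd)
  \<comment> \<open>1 shares its coset with 2, so it is an exponent of a zero, and the complement of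
    the negatives omits -1.\<close>
  have "1 \<in> coset_union n {2..\<delta>}"
    unfolding coset_union_from_1[OF m \<delta>(1)] using \<delta> by (intro mem_coset_unionI[of 1 _ _ 0]) auto
  then have notm1: "n - 1 \<notin> coset_union n {b..e}" using compl[of "n - 1"] \<delta> by simp
  have "j0 = b"
  proof (rule ccontr)
    assume "j0 \<noteq> b"
    then have "j0 - 1 \<in> {b..e}" using j0(1) b by auto
    moreover have "[n - 1 = 2 ^ 0 * (j0 - 1)] (mod n)"
    proof -
      obtain k where k: "j0 = n * k" using nj0 by blast
      with j0(1) b have "k > 0" by (auto intro: gr0I)
      then obtain k' where "k = Suc k'" using gr0_conv_Suc by blast
      then have "j0 - 1 = (n - 1) + n * k'" using k \<delta> by simp
      then show ?thesis by (simp add: cong_def)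
    qed
    ultimately show False using notm1 unfolding coset_union_def by blast
  qed
  have cong_b: "[b + k = k] (mod n)" for k
    using nj0 \<open>j0 = b\<close> by (auto simp: cong_def)
  have short: "e - b < n - \<tau>"
  proof (rule ccontr)
    assume "\<not> e - b < n - \<tau>"
    then have "b + (n - \<tau>) \<in> {b..e}" using j0(1) by auto
    then have "n - \<tau> \<in> coset_union n {b..e}"
      using cong_b[of "n - \<tau>"]
      by (intro mem_coset_unionI[of "b + (n - \<tau>)" _ _ 0]) (auto simp: cong_sym_eq)
    then show False using compl[of "n - \<tau>"] \<tau> by simp
  qed
  have "u \<notin> coset_union n {2..\<delta>}"
  proof
    assume "u \<in> coset_union n {2..\<delta>}"
    then obtain j i where j: "j \<in> {2..\<delta>}" "[u = 2 ^ i * j] (mod n)"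
      by (auto simp: coset_union_def)
    obtain i' where "[2 ^ i' * u = j] (mod n)" by (rule coset_sym[OF m j(2)])
    then have "2 ^ i' * u mod n = j" using j(1) \<delta> by (simp add: cong_def)
    then show False using u(2)[of i'] j(1) by simp
  qed
  then have "n - u \<in> coset_union n {b..e}" using compl[of "n - u"] u(1) by simp
  then obtain j i where j: "j \<in> {b..e}" "[n - u = 2 ^ i * j] (mod n)"
    by (auto simp: coset_union_def)
  obtain i' where i': "[2 ^ i' * (n - u) = j] (mod n)" by (rule coset_sym[OF m j(2)])
  \<comment> \<open>As \<open>b\<close> is 0 modulo \<open>n\<close>, the offset \<open>k\<close> is
    the residue of \<open>j\<close>. It is congruent to the negative of an element of the coset of
    \<open>u\<close>; the sum of the two would be a multiple of \<open>n\<close> strictly between 0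
    and \<open>n\<close>.\<close>
  define k where "k = j - b"
  have k: "k < n - \<tau>" "[2 ^ i' * (n - u) = k] (mod n)"
    using short j(1) i' cong_b[of k] by (auto simp: k_def cong_def)
  then have "[2 ^ i' * (n - u) + 2 ^ i' * u = k + 2 ^ i' * u] (mod n)"
    by (intro cong_add cong_refl)
  moreover have "2 ^ i' * (n - u) + 2 ^ i' * u = 2 ^ i' * n"
    using u(1) by (simp flip: distrib_left)
  ultimately have "n dvd k + 2 ^ i' * u"
    by (metis cong_0_iff cong_sym cong_trans dvd_triv_right)
  then have "n dvd k + 2 ^ i' * u mod n"
    by (metis mod_add_right_eq mod_eq_0_iff_dvd)
  moreover have "k + 2 ^ i' * u mod n < n" "0 < k + 2 ^ i' * u mod n"
    using u(2)[of i'] k(1) by linarith+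
  ultimately show False by (auto dest: dvd_imp_le)
qed

section \<open>Coset leaders and separating cosets\<close>

lemma coset_leader_le_iff:
  assumes "n > 0"
  shows "coset_leader n t \<le> d \<longleftrightarrow> (\<exists>i. 2 ^ i * t mod n \<le> d)"
proof -
  have "cyclotomic_coset n t \<subseteq> {..<n}" using assms by (auto simp: cyclotomic_coset_def)
  then have "finite (cyclotomic_coset n t)" using finite_subset by blast
  then show ?thesis
    unfolding coset_leader_def by (subst Min_le_iff) (auto simp: cyclotomic_coset_def)
qed

lemma largest_coset_leader_le_iff:
  assumes "n > 0"
  shows "largest_coset_leader n \<le> d \<longleftrightarrow> (\<forall>t<n. \<exists>i. 2 ^ i * t mod n \<le> d)"
  unfolding largest_coset_leader_def using assms
  by (subst Max_le_iff) (auto simp: coset_leader_le_iff)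

text \<open>The whole orbit of 7 under doubling can be listed. Its largest element is
  \<open>7 * 2 ^ p\<close>, which equals \<open>(21 * n + 7) / 32\<close> and is the last one before
  the first reduction modulo \<open>n\<close>.\<close>

lemma coset_of_7:
  fixes n p i :: nat
  assumes n: "3 * n + 1 = 32 * 2 ^ p" "n \<ge> 85"
  shows "7 \<le> 2 ^ i * 7 mod n \<and> 32 * (2 ^ i * 7 mod n) \<le> 21 * n + 7"
proof -
  \<comment> \<open>The last four elements are those after the first reduction, written as multiples
    to avoid division; doubling \<open>(n + 7) / 2\<close> leads back to 7.\<close>
  let ?A = "{y. (\<exists>k\<le>p. y = 7 * 2 ^ k) \<or> 16 * y = 5 * n + 7 \<or> 8 * y = 5 * n + 7
     \<or> 4 * y = n + 7 \<or> 2 * y = n + 7}"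
  have "2 ^ i * 7 mod n \<in> ?A"
  proof (induction i)
    case 0
    show ?case using n(2) by (auto intro!: exI[of _ 0])
  next
    case (Suc i)
    define y where "y = 2 ^ i * 7 mod n"
    have step: "2 ^ Suc i * 7 mod n = 2 * y mod n"
      by (simp add: y_def mod_mult_right_eq mult.assoc)
    have y: "y \<in> ?A" using Suc by (simp only: y_def)
    have "2 * y mod n \<in> ?A"
    proof -
      consider k where "k < p" "y = 7 * 2 ^ k" | "y = 7 * 2 ^ p" | "16 * y = 5 * n + 7"
        | "8 * y = 5 * n + 7" | "4 * y = n + 7" | "2 * y = n + 7"
        using y le_neq_implies_less unfolding mem_Collect_eq by metis
      then show ?thesis
      proof cases
        case 1
        then have "2 ^ Suc k \<le> (2::nat) ^ p" by (intro power_increasing) auto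
        then have "2 * y < n" using 1 n by simp
        then have "2 * y mod n = 7 * 2 ^ Suc k" using 1 by simp
        then show ?thesis using 1(1) Suc_leI by blast
      next
        case 2
        then have "16 * (2 * y) = 16 * n + (5 * n + 7)" using n by simp
        then have "2 * y mod n = 2 * y - n" "16 * (2 * y - n) = 5 * n + 7"
          using n(2) by (simp_all add: le_mod_geq mod_if)
        then show ?thesis by simp
      next
        case 3
        then have "2 * y mod n = 2 * y" using n(2) by simp
        then show ?thesis using 3 by simp
      next
        case 4
        then have "2 * y mod n = 2 * y - n" using n(2) by (simp add: mod_if)
        then show ?thesis using 4 by auto
      next
        case 5
        then have "2 * y mod n = 2 * y" using n(2) by simp
        then show ?thesis using 5 by simp
      next
        case 6
        then have "2 * y mod n = 7 * 2 ^ 0" using n(2) by (simp add: mod_if)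
        then show ?thesis by blast
      qed
    qed
    then show ?case by (simp only: step)
  qed
  moreover have "7 \<le> y \<and> 32 * y \<le> 21 * n + 7" if y: "y \<in> ?A" for y
  proof -
    consider k where "k \<le> p" "y = 7 * 2 ^ k" | "16 * y = 5 * n + 7"
      | "8 * y = 5 * n + 7" | "4 * y = n + 7" | "2 * y = n + 7"
      using y by auto
    then show ?thesis
    proof cases
      case 1
      then have "1 \<le> (2::nat) ^ k" "2 ^ k \<le> (2::nat) ^ p" by (auto intro: power_increasing)
      then show ?thesis using 1(2) n(1) by linarith
    qed (use n(2) in linarith)+
  qed
  ultimately show ?thesis by blast
qed

text \<open>
  Doubling modulo \<open>n\<close> rotates the \<open>2 * s\<close> binary digits of \<open>3 * t\<close>, so the word of \<open>3 * u\<close> should have no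
  rotation as small as \<open>3 * \<delta>\<close> or larger than \<open>3 * \<tau>\<close>. The words used for \<open>u\<close> are \<open>10101\<close> padded with
  zeros (\<open>u = 7\<close>), \<open>0011\<close> repeated (\<open>u = n / 5\<close>), and the complement of the first (\<open>u = n - 7\<close>);
  for \<open>\<delta> \<ge> (n - 1) / 4\<close> already \<open>n - 1\<close> is a zero.
\<close>

lemma separating_coset:
  fixes n s \<delta> :: nat
  assumes s: "even s" "s \<ge> 2" and n: "3 * n + 1 = 2 ^ (2 * s)"
    and \<delta>: "2 \<le> \<delta>" "\<delta> < largest_coset_leader n"
  obtains \<tau> u where "0 < \<tau>" "\<tau> < n" "\<tau> \<in> coset_union n {2..\<delta>}" "u < n"
    "\<And>i. \<delta> < 2 ^ i * u mod n \<and> 2 ^ i * u mod n \<le> \<tau>"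
proof -
  obtain k where k: "s = 2 * k" using s(1) by blast
  have n5: "n \<ge> 5" using n power_increasing[of 4 "2 * s" "2::nat"] s(2) by simp
  have mem: "t \<in> coset_union n {2..\<delta>}" if "2 ^ i * j = t" "2 \<le> j" "j \<le> \<delta>" for i j t
    using that by (intro mem_coset_unionI[of j _ _ i]) auto
  have "2 * s - 2 + 2 = 2 * s" using s(2) by simp
  then have q: "3 * n + 1 = 4 * 2 ^ (2 * s - 2)"
    using power_add[of "2::nat" "2 * s - 2" 2] n by simp
  show thesis
  proof (cases "n - 1 \<le> 4 * \<delta>")
    case True
    obtain u where u: "u < n" "\<And>i. \<delta> < 2 ^ i * u mod n"
      using \<delta>(2) largest_coset_leader_le_iff[of n \<delta>] n5 by (auto simp: not_le)
    \<comment> \<open>4 divides \<open>3 * n + 1\<close>, hence \<open>n - 1\<close>. With \<tau> =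
      \<open>n - 1\<close> the upper bound holds trivially, so any \<open>u\<close> whose leader
      exceeds \<delta> serves.\<close>
    have "\<exists>j. n - 1 = 4 * j" using q by presburger
    then obtain j where j: "n - 1 = 4 * j" by blast
    show ?thesis
    proof (rule that[of "n - 1" u])
      show "n - 1 \<in> coset_union n {2..\<delta>}"
      proof (cases "j \<ge> 2")
        case True
        then show ?thesis using mem[of 2 j] j \<open>n - 1 \<le> 4 * \<delta>\<close> by simp
      next
        \<comment> \<open>\<open>j = 1\<close> is outside the interval; it occurs for
          \<open>n = 5\<close>, where \<open>n - 1\<close> is \<open>2 * 2\<close>.\<close>
        case False
        then have "j = 1" using j n5 by simp
        then show ?thesis using mem[of 1 2] j \<delta>(1) by simp
      qed
      show "\<delta> < 2 ^ i * u mod n \<and> 2 ^ i * u mod n \<le> n - 1" for i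
        using u(2) n5 by (simp add: less_Suc_eq_le[symmetric])
    qed (use n5 u in auto)
  next
    case False
    \<comment> \<open>\<open>s = 2\<close> gives \<open>n = 5\<close>, and then
      \<open>n - 1 <= 4 * \<delta>\<close>, which is the other case. So \<open>s\<close> is at least
      4 and \<open>n\<close> at least 85.\<close>
    then have "k \<noteq> 1" using n \<delta>(1) by (auto simp: k)
    then have "k \<ge> 2" using s k by auto
    then have "2 * s - 5 + 5 = 2 * s" "2 * s - 4 + 4 = 2 * s" using k by simp_all
    then have p: "3 * n + 1 = 32 * 2 ^ (2 * s - 5)" and r: "3 * n + 1 = 16 * 2 ^ (2 * s - 4)"
      using power_add[of "2::nat" "2 * s - 5" 5] power_add[of "2::nat" "2 * s - 4" 4] n by simp_all
    have n85: "n \<ge> 85" using n power_increasing[of 8 "2 * s" "2::nat"] k \<open>k \<ge> 2\<close> by simp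
    note c7 = coset_of_7[OF p n85]
    \<comment> \<open>For even \<open>s\<close>, \<open>2 ^ (2 * s)\<close> is a power of 16, so 15
      divides \<open>3 * n\<close>; this provides the exponent \<open>n / 5\<close>.\<close>
    have "[16 ^ k = 1] (mod (15::nat))"
      using cong_pow[of 16 1 "15::nat" k] by (simp add: cong_def)
    then have "\<exists>c. n = 5 * c"
    proof -
      have "(2::nat) ^ (2 * s) = 16 ^ k" by (simp add: k power_mult[of 2 4 k, simplified])
      then have "(3 * n + 1) mod 15 = 1" using \<open>[16 ^ k = 1] (mod 15)\<close> n by (simp add: cong_def)
      then show ?thesis by presburger
    qed
    then obtain c where c: "n = 5 * c" by blast
    consider "\<delta> < 5" | "5 \<le> \<delta>" "\<delta> < c" | "c \<le> \<delta>" by linarith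
    then show ?thesis
    proof cases
      case 1
      show ?thesis
      \<comment> \<open>Here \<open>3 * \<tau>\<close> has the word 11 followed by zeros, above
        every rotation of the padded 10101; in numbers, \<open>(3 * n + 1) / 4\<close> exceeds
        \<open>(21 * n + 7) / 32\<close>.\<close>
      proof (rule that[of "2 ^ (2 * s - 2)" 7])
        have "2 * s - 3 + 1 = 2 * s - 2" using s(2) by simp
        then show "2 ^ (2 * s - 2) \<in> coset_union n {2..\<delta>}"
          using mem[of "2 * s - 3" 2] \<delta>(1) power_add[of "2::nat" "2 * s - 3" 1] by simp
        show "\<delta> < 2 ^ i * 7 mod n \<and> 2 ^ i * 7 mod n \<le> 2 ^ (2 * s - 2)" for i
          using c7[of i] q n85 1 by linarith
      qed (use q n85 in auto)
    next
      case 2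
      \<comment> \<open>The coset of \<open>n / 5\<close> consists of multiples \<open>r * c\<close>
        with \<open>r\<close> a nonzero residue modulo 5, so it lies between \<open>c\<close> and
        \<open>4 * c\<close>.\<close>
      have "2 ^ i * c mod n = (2 ^ i mod 5) * c" for i
        unfolding c by (simp add: mult_mod_left)
      moreover have "1 \<le> (2::nat) ^ i mod 5 \<and> 2 ^ i mod 5 \<le> (4::nat)" for i
      proof -
        have "coprime (2 ^ i) (5 :: nat)" by simp
        then have "\<not> 5 dvd (2::nat) ^ i" by (metis coprime_absorb_right one_eq_numeral_iff nat_dvd_1_iff_1 semiring_norm(84) coprime_common_divisor dvd_refl)
        then show ?thesis by (simp add: dvd_eq_mod_eq_0)
      qed
      ultimately have orbit: "c \<le> 2 ^ i * c mod n \<and> 2 ^ i * c mod n \<le> 4 * c" for i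
        by (metis mult_le_mono1 mult_1)
      show ?thesis
      \<comment> \<open>This \<tau> comes from the exponent 5 and equals
        \<open>5 * (3 * n + 1) / 16\<close>, which is above \<open>4 * n / 5\<close>.\<close>
      proof (rule that[of "2 ^ (2 * s - 4) * 5" c])
        show "2 ^ (2 * s - 4) * 5 \<in> coset_union n {2..\<delta>}"
          using mem[of "2 * s - 4" 5] 2 by simp
        show "\<delta> < 2 ^ i * c mod n \<and> 2 ^ i * c mod n \<le> 2 ^ (2 * s - 4) * 5" for i
          using orbit[of i] r c 2 by linarith
      qed (use r c n85 in auto)
    next
      case 3
      \<comment> \<open>16 divides \<open>3 * n + 1\<close>, so \<open>n\<close> is 5 modulo 16. The
        quotient \<open>j\<close> is below \<open>n / 5\<close>, hence at most \<delta>, and its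
        coset contains \<open>n - 5\<close>.\<close>
      have "\<exists>j. n - 5 = 16 * j" using r n85 by presburger
      then obtain j where j: "n - 5 = 16 * j" by blast
      show ?thesis
      proof (rule that[of "n - 5" "n - 7"])
        show "n - 5 \<in> coset_union n {2..\<delta>}"
          using mem[of 4 j] j 3 c n85 by simp
        show "\<delta> < 2 ^ i * (n - 7) mod n \<and> 2 ^ i * (n - 7) mod n \<le> n - 5" for i
        proof -
          let ?y = "2 ^ i * 7 mod n"
          have y: "7 \<le> ?y" "32 * ?y \<le> 21 * n + 7" using c7[of i] by auto
          have "[2 ^ i * (n - 7) + 2 ^ i * 7 = 0] (mod n)"
            using n85 by (simp add: cong_0_iff flip: distrib_left)
          moreover have "[(n - ?y) + ?y = 0] (mod n)"
            using n85 by (simp add: cong_0_iff)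
          moreover have "[?y = 2 ^ i * 7] (mod n)" by (simp add: cong_def)
          ultimately have "[2 ^ i * (n - 7) = n - ?y] (mod n)"
            by (meson cong_add_rcancel_nat cong_add_lcancel_nat cong_add cong_refl cong_sym cong_trans)
          then have "2 ^ i * (n - 7) mod n = n - ?y" using y n85 by (simp add: cong_def)
          \<comment> \<open>The upper bound on the coset of 7 reflects to the lower bound
            \<open>(11 * n - 7) / 32\<close>, which exceeds \<delta> because
            \<open>4 * \<delta> < n - 1\<close>.\<close>
          then show ?thesis using y False n85 by linarith
        qed
      qed (use n85 in auto)
    qed
  qed
qed

section \<open>Binary cyclic codes and their zeros\<close>

declare add_bit_eq_xor [simp del] mult_bit_eq_and [simp del]

text \<open>Multiplication by a nonzero \<open>x\<close> permutes the nonzero elements; comparing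
  their product before and after gives the claim.\<close>

lemma finite_field_power_card:
  fixes x :: "'a :: {field, finite}"
  shows "x ^ CARD('a) = x"
proof (cases "x = 0")
  case True
  then show ?thesis by (simp add: zero_power)
next
  case False
  let ?P = "\<Prod>y\<in>UNIV - {0 :: 'a}. y"
  have "?P = (\<Prod>y\<in>UNIV - {0}. x * y)"
    by (rule prod.reindex_bij_witness[of _ "\<lambda>y. x * y" "\<lambda>y. y / x"]) (use False in auto)
  also have "\<dots> = x ^ (CARD('a) - 1) * ?P"
    by (simp add: prod.distrib card_Diff_singleton)
  finally have "x ^ (CARD('a) - 1) = 1"
    by simp
  moreover have "x ^ CARD('a) = x * x ^ (CARD('a) - 1)"
    by (simp flip: power_Suc)
  ultimately show ?thesis by simp
qed

definition word_of :: "nat \<Rightarrow> (nat \<Rightarrow> bit) \<Rightarrow> bit poly" where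
  "word_of n c = (\<Sum>i<n. monom (c i) i)"

lemma coeff_word_of: "coeff (word_of n c) i = (if i < n then c i else 0)"
  by (simp add: word_of_def coeff_sum sum.delta')

lemma degree_word_of: "n > 0 \<Longrightarrow> degree (word_of n c) < n"
  by (metis coeff_word_of degree_0 gr0I le_degree leading_coeff_0_iff not_le)

text \<open>The sum is the value of a polynomial of degree at most \<open>2 ^ (m - 1)\<close>, less
  than the field size, with linear coefficient 1 because \<open>0 \<in> R\<close>; it cannot vanish
  everywhere. It supplies elements with nonzero trace and trace words with a prescribed nonzero
  value.\<close>

lemma nonconstant_linearized_poly_nonzero:
  fixes R :: "nat set"
  assumes "CARD('a :: {field, finite}) = 2 ^ m" "R \<subseteq> {..<m}" "0 \<in> R"
  obtains a :: "'a :: {field, finite}" where "(\<Sum>r\<in>R. a ^ 2 ^ r) \<noteq> 0"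
proof (rule ccontr)
  assume "\<not> thesis"
  then have all: "(\<Sum>r\<in>R. a ^ 2 ^ r) = 0" for a :: 'a
    using that by blast
  define P :: "'a poly" where "P = (\<Sum>r\<in>R. monom 1 (2 ^ r))"
  have "finite R" using assms(2) finite_subset by blast
  moreover have "(2::nat) ^ r = 1 \<longleftrightarrow> r = 0" for r :: nat by simp
  ultimately have "coeff P 1 = 1"
    using assms(3) by (simp add: P_def coeff_sum sum.delta)
  then have "P \<noteq> 0" by auto
  moreover have "poly P a = 0" for a
    using all by (simp add: P_def poly_sum poly_monom)
  ultimately have "2 ^ m \<le> degree P"
    using card_poly_roots_bound[of P] assms(1) by simp
  moreover have "degree P \<le> 2 ^ (m - 1)"
    unfolding P_def
  proof (rule degree_sum_le)
    fix r assume "r \<in> R"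
    then have "r \<le> m - 1" using assms(2) by auto
    then show "degree (monom (1::'a) (2 ^ r)) \<le> 2 ^ (m - 1)"
      by (simp add: degree_monom_eq power_increasing)
  qed fact
  moreover have "(2::nat) ^ (m - 1) < 2 ^ m"
    using assms(2,3) by (intro power_strict_increasing) auto
  ultimately show False by linarith
qed

text \<open>The last assumption says that \<beta> has order exactly \<open>n\<close>. Characteristic
  2 is derived from the cardinality.\<close>

locale primitive_root_char_2 =
  fixes \<beta> :: "'a :: {field, finite}" and n m :: nat
  assumes card: "CARD('a) = 2 ^ m"
    and n_pos: "n > 0"
    and power_eq_1_iff: "\<And>k. \<beta> ^ k = 1 \<longleftrightarrow> n dvd k"
begin

lemma power_card [simp]: "(x :: 'a) ^ 2 ^ m = x"
  using finite_field_power_card[of x] card by simp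

lemma m_pos: "m > 0"
proof (rule ccontr)
  assume "\<not> m > 0"
  then have "CARD('a) = 1" using card by simp
  then show False by (metis (full_types) UNIV_I card_1_singletonE singletonD zero_neq_one)
qed

text \<open>Raising to the even power \<open>2 ^ m\<close> fixes every element but sends -1 to
  1.\<close>

lemma two_eq_0: "(2 :: 'a) = 0"
proof -
  have "(- 1 :: 'a) = (- 1) ^ 2 ^ m" by simp
  also have "\<dots> = 1" using m_pos by (simp del: power_card)
  finally have "(1 :: 'a) + 1 = 0" by (metis add.right_inverse)
  then show ?thesis by (simp only: one_add_one)
qed

lemma add_self [simp]: "(x :: 'a) + x = 0"
  using two_eq_0 by (metis mult_2 mult_zero_left)

lemma power_two_add: "(x + y :: 'a) ^ 2 ^ r = x ^ 2 ^ r + y ^ 2 ^ r"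
proof (induction r)
  case (Suc r)
  have "(x + y) ^ 2 ^ Suc r = ((x + y) ^ 2 ^ r)\<^sup>2"
    by (simp add: power_mult[symmetric] mult.commute)
  also have "\<dots> = (x ^ 2 ^ r)\<^sup>2 + (y ^ 2 ^ r)\<^sup>2"
    by (simp add: Suc power2_sum two_eq_0)
  finally show ?case by (simp add: power_mult[symmetric] mult.commute)
qed simp

lemma power_two_sum: "(\<Sum>i\<in>A. f i :: 'a) ^ 2 ^ r = (\<Sum>i\<in>A. f i ^ 2 ^ r)"
  by (induction A rule: infinite_finite_induct) (simp_all add: power_two_add zero_power)

text \<open>A separate name for the embedding into this field, to which the homomorphism rules of
  characteristic 2 can be attached.\<close>

definition F2 :: "bit \<Rightarrow> 'a" where "F2 b = of_bit b"

lemma F2_simps [simp]: "F2 0 = 0" "F2 1 = 1" "F2 b ^ 2 ^ r = F2 b" "F2 b = 0 \<longleftrightarrow> b = 0"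
  by (cases b; simp add: F2_def)+

lemma F2_add: "F2 (a + b) = F2 a + F2 b"
  by (cases a; cases b) simp_all

lemma F2_mult: "F2 (a * b) = F2 a * F2 b"
  by (cases a; cases b) simp_all

lemma F2_sum: "F2 (\<Sum>i\<in>A. f i) = (\<Sum>i\<in>A. F2 (f i))"
  by (induction A rule: infinite_finite_induct) (simp_all add: F2_add)

section \<open>Evaluation of binary polynomials and minimal polynomials\<close>

abbreviation ev :: "bit poly \<Rightarrow> 'a \<Rightarrow> 'a" where "ev \<equiv> poly_F2"

lemma ev_altdef: "ev p x = poly (map_poly F2 p) x"
  unfolding poly_F2_def F2_def ..

lemma ev_0 [simp]: "ev 0 x = 0"
  by (simp add: ev_altdef)

lemma ev_pCons [simp]: "ev (pCons c p) x = F2 c + x * ev p x"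
  by (simp add: ev_altdef map_poly_pCons)

lemma ev_add: "ev (p + q) x = ev p x + ev q x"
  by (induction p q rule: poly_induct2) (simp_all add: F2_add algebra_simps)

lemma ev_smult: "ev (smult c p) x = F2 c * ev p x"
  by (induction p) (simp_all add: F2_mult algebra_simps)

lemma ev_mult: "ev (p * q) x = ev p x * ev q x"
  by (induction p) (simp_all add: ev_add ev_smult algebra_simps)

lemma bit_poly_diff: "p - q = p + (q :: bit poly)"
  by (intro poly_eqI) (simp only: coeff_diff coeff_add minus_bit_def)

lemma ev_diff: "ev (p - q) x = ev p x + ev q x"
  by (simp add: bit_poly_diff ev_add)

lemma ev_monom: "ev (monom c k) x = F2 c * x ^ k"
  by (simp add: ev_altdef map_poly_monom poly_monom)

lemma ev_1 [simp]: "ev 1 x = 1"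
  by (simp add: ev_altdef map_poly_1')

lemma ev_eq_sum:
  assumes "degree p < n"
  shows "ev p x = (\<Sum>i<n. F2 (coeff p i) * x ^ i)"
proof -
  have "degree (map_poly F2 p) < n"
    using map_poly_degree_leq[of F2 p] assms by simp
  then have "coeff (map_poly F2 p) i = 0" if "i \<ge> n" for i
    using that by (simp add: coeff_eq_0)
  then have "ev p x = (\<Sum>i<n. coeff (map_poly F2 p) i * x ^ i)"
    unfolding ev_altdef poly_altdef using \<open>degree (map_poly F2 p) < n\<close>
    by (intro sum.mono_neutral_left) (auto intro: coeff_eq_0 simp: not_le)
  then show ?thesis by (simp add: coeff_map_poly)
qed

text \<open>The Frobenius map fixes binary coefficients; hence zeros of binary polynomials come in
  full sets of conjugates.\<close>

lemma ev_power_two: "ev p (x ^ 2 ^ r) = ev p x ^ 2 ^ r"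
  by (induction p) (simp_all add: power_two_add power_mult_distrib zero_power)

text \<open>The annihilating polynomial \<open>f\<close> ensures that the description in
  \<open>min_poly\<close> has a solution. Two solutions agree, as their difference vanishes at
  \<open>x\<close> and has smaller degree; division with remainder gives the divisibility.\<close>

lemma min_poly_dvd_iff:
  assumes "ev f x = 0" "f \<noteq> 0"
  shows "min_poly x dvd v \<longleftrightarrow> ev v x = 0"
proof -
  let ?Q = "\<lambda>p. lead_coeff p = 1 \<and> ev p x = 0 \<and> (\<forall>q. q \<noteq> 0 \<longrightarrow> ev q x = 0 \<longrightarrow> degree p \<le> degree q)"
  obtain p where p: "p \<noteq> 0 \<and> ev p x = 0"
    "\<And>q. q \<noteq> 0 \<and> ev q x = 0 \<Longrightarrow> degree p \<le> degree q"
    using assms ex_has_least_nat[of "\<lambda>p. p \<noteq> 0 \<and> ev p x = 0" f degree] by blast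
  \<comment> \<open>A nonzero bit is 1, so an annihilating polynomial of least degree is
    automatically monic.\<close>
  then have Qp: "?Q p" using bit_not_zero_iff[of "lead_coeff p"] leading_coeff_0_iff[of p] by blast
  have uniq: "q = p" if "?Q q" for q
  proof (rule ccontr)
    assume "q \<noteq> p"
    then have nz: "q - p \<noteq> 0" by simp
    have deg: "degree q = degree p" using that Qp by (metis le_antisym leading_coeff_0_iff zero_neq_one)
    have "ev (q - p) x = 0" using that Qp by (simp add: ev_diff)
    then have "degree p \<le> degree (q - p)" using Qp nz by blast
    moreover have "coeff (q - p) (degree p) = 0"
      using that Qp deg by (metis coeff_diff diff_self)
    moreover have "degree (q - p) \<le> degree p"
      using deg by (simp add: degree_diff_le)
    ultimately show False using nz by (metis le_antisym leading_coeff_0_iff)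
  qed
  have "?Q (min_poly x)"
    unfolding min_poly_def by (rule theI[of ?Q p]) (use Qp uniq in blast)+
  then have mp: "min_poly x = p" using uniq by blast
  show ?thesis unfolding mp
  proof
    assume "p dvd v"
    then show "ev v x = 0" using Qp by (auto simp: ev_mult elim!: dvdE)
  next
    assume v: "ev v x = 0"
    have "ev v x = ev (v div p * p) x + ev (v mod p) x"
      by (simp flip: ev_add)
    then have "ev (v mod p) x = 0" using v Qp by (simp add: ev_mult)
    moreover have "degree (v mod p) < degree p" if "v mod p \<noteq> 0"
      using that p(1) degree_mod_less by blast
    ultimately have "v mod p = 0"
      using Qp by (meson not_le)
    then show "p dvd v" by (simp add: dvd_eq_mod_eq_0)
  qed
qed

section \<open>Cyclic codes given by their zeros\<close>

definition code_with_zeros :: "'a set \<Rightarrow> bit poly set" where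
  "code_with_zeros Z = {v. degree v < n \<and> (\<forall>x\<in>Z. ev v x = 0)}"

lemma \<beta>_power_n [simp]: "\<beta> ^ n = 1"
  by (simp add: power_eq_1_iff)

lemma \<beta>_nonzero [simp]: "\<beta> \<noteq> 0"
  using \<beta>_power_n n_pos by (metis power_0_left zero_neq_one less_numeral_extra(3))

lemma degree_modulus: "degree (monom 1 n - 1 :: bit poly) = n"
  using n_pos by (simp add: bit_poly_diff degree_add_eq_left degree_monom_eq)

lemma power_root: "(\<beta> ^ t) ^ n = 1"
  by (simp add: power_eq_1_iff flip: power_mult)

lemma power_eq_iff_cong: "\<beta> ^ i = \<beta> ^ k \<longleftrightarrow> [i = k] (mod n)"
proof -
  have *: "\<beta> ^ k = \<beta> ^ i \<longleftrightarrow> [k = i] (mod n)" if "i \<le> k" for i k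
  proof -
    have "\<beta> ^ k = \<beta> ^ i * \<beta> ^ (k - i)" using that by (simp flip: power_add)
    then have "\<beta> ^ k = \<beta> ^ i \<longleftrightarrow> n dvd k - i" by (simp flip: power_eq_1_iff)
    then show ?thesis using that by (simp add: cong_altdef_nat)
  qed
  show ?thesis using *[of i k] *[of k i] by (metis cong_sym nle_le)
qed

lemma inverse_power: "t \<le> n \<Longrightarrow> inverse (\<beta> ^ t) = \<beta> ^ (n - t)"
  by (rule inverse_unique) (simp flip: power_add)

text \<open>As \<open>g\<close> divides the modulus, reduction preserves divisibility by
  \<open>g\<close>, and a multiple of \<open>g\<close> of degree below \<open>n\<close> is its own
  remainder.\<close>

lemma cyclic_code_eq:
  assumes "g dvd monom 1 n - 1"
  shows "cyclic_code n g = {v. degree v < n \<and> g dvd v}"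
proof -
  let ?M = "monom 1 n - 1 :: bit poly"
  note deg = degree_modulus
  show ?thesis
  proof (intro equalityI subsetI)
    fix v assume "v \<in> cyclic_code n g"
    then obtain f where "v = (f * g) mod ?M" by (auto simp: cyclic_code_def)
    moreover have "degree ((f * g) mod ?M) < n"
      using degree_mod_less[of ?M "f * g"] deg n_pos
      by (metis degree_0 less_numeral_extra(3))
    ultimately show "v \<in> {v. degree v < n \<and> g dvd v}"
      using assms by (simp add: dvd_mod)
  next
    fix v assume "v \<in> {v. degree v < n \<and> g dvd v}"
    then have v: "degree v < n" "g dvd v" by auto
    then have "v = (v div g * g) mod ?M" by (simp add: mod_poly_less deg)
    then show "v \<in> cyclic_code n g" unfolding cyclic_code_def by blast
  qed
qed

text \<open>Each power of \<beta> is a root of the modulus, so the least common multiple divides the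
  modulus; it divides a word exactly if all the minimal polynomials do.\<close>

lemma bch_code_eq: "bch_code \<beta> n d b = code_with_zeros ((\<lambda>j. \<beta> ^ j) ` {b..b + d - 2})"
proof -
  let ?M = "monom 1 n - 1 :: bit poly"
  let ?g = "Lcm ((\<lambda>j. min_poly (\<beta> ^ j)) ` {b..b + d - 2})"
  have M: "?M \<noteq> 0" using degree_modulus n_pos by (metis degree_0 less_numeral_extra(3))
  have "ev ?M (\<beta> ^ j) = 0" for j
    by (simp add: ev_diff ev_monom power_mult[symmetric] mult.commute[of j]) (simp add: power_mult)
  then have dvd: "min_poly (\<beta> ^ j) dvd v \<longleftrightarrow> ev v (\<beta> ^ j) = 0" for j v
    using min_poly_dvd_iff M by blast
  have g: "?g dvd v \<longleftrightarrow> (\<forall>j\<in>{b..b + d - 2}. ev v (\<beta> ^ j) = 0)" for v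
    by (simp only: Lcm_dvd_iff ball_simps dvd)
  have "?g dvd ?M" unfolding g using \<open>\<And>j. ev ?M (\<beta> ^ j) = 0\<close> by blast
  then show ?thesis
    unfolding bch_code_def code_with_zeros_def by (subst cyclic_code_eq) (auto simp: g)
qed

text \<open>Orthogonality for Fourier inversion: a geometric sum for \<open>x \<noteq> 1\<close>,
  and otherwise \<open>n\<close> itself, which is 1 in the field since \<open>n\<close> is
  odd.\<close>

lemma sum_powers_root_of_unity:
  assumes "x ^ n = (1 :: 'a)"
  shows "(\<Sum>i<n. x ^ i) = (if x = 1 then 1 else 0)"
proof (cases "x = 1")
  case True
  \<comment> \<open>In characteristic 2 squaring is injective, so for \<open>n = 2 * k\<close>
    already \<open>\<beta> ^ k\<close> would be 1.\<close>
  have "odd n"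
  proof
    assume "even n"
    then obtain k where k: "n = 2 * k" by blast
    then have "(\<beta> ^ k)\<^sup>2 = 1" using \<beta>_power_n by (simp add: power_mult[symmetric] mult.commute)
    then have "(\<beta> ^ k + 1)\<^sup>2 = 0" by (simp add: power2_sum two_eq_0)
    then have "\<beta> ^ k = 1" by (metis add_self add_right_imp_eq power_eq_0_iff)
    then have "n dvd k" by (simp add: power_eq_1_iff)
    then show False using k n_pos by (auto dest: dvd_imp_le)
  qed
  then have "(of_nat n :: 'a) = 1" by (auto elim!: oddE simp: two_eq_0)
  then show ?thesis using True by simp
next
  case False
  then have "(x - 1) * (\<Sum>i<n. x ^ i) = 0"
    using assms by (metis power_diff_1_eq diff_self)
  then show ?thesis using False by simp
qed

section \<open>The absolute trace to the prime field and words of traces\<close>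

definition tr :: "'a \<Rightarrow> 'a" where "tr z = (\<Sum>r<m. z ^ 2 ^ r)"

lemma tr_sum: "tr (\<Sum>i\<in>A. f i) = (\<Sum>i\<in>A. tr (f i))"
  unfolding tr_def power_two_sum by (rule sum.swap)

lemma tr_F2: "tr (F2 b * z) = F2 b * tr z"
  by (simp add: tr_def power_mult_distrib sum_distrib_left)

text \<open>Squaring permutes the summands cyclically, so the trace equals its own square.\<close>

lemma tr_cases: "tr z = 0 \<or> tr z = 1"
proof -
  have "(tr z)\<^sup>2 = (\<Sum>r<m. z ^ 2 ^ Suc r)"
    unfolding tr_def using power_two_sum[of "\<lambda>r. z ^ 2 ^ r" "{..<m}" 1]
    by (simp add: power_mult[symmetric] mult.commute)
  also have "\<dots> = tr z"
    unfolding tr_def using sum.lessThan_Suc_shift[of "\<lambda>r. z ^ 2 ^ r" m]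
    by (simp add: add.commute)
  finally show ?thesis by (simp add: power2_eq_square)
qed

text \<open>The letters are the traces \<open>tr (a * x ^ i)\<close>, turned from field elements
  into bits by a test for zero.\<close>

definition trace_word :: "'a \<Rightarrow> 'a \<Rightarrow> bit poly" where
  "trace_word a x = word_of n (\<lambda>i. if tr (a * x ^ i) = 0 then 0 else 1)"

lemma degree_trace_word: "degree (trace_word a x) < n"
  unfolding trace_word_def using n_pos by (rule degree_word_of)

lemma coeff_trace_word: "i < n \<Longrightarrow> F2 (coeff (trace_word a x) i) = tr (a * x ^ i)"
  using tr_cases[of "a * x ^ i"] by (auto simp: trace_word_def coeff_word_of)

text \<open>After expanding the trace and exchanging sums, orthogonality keeps only those
  \<open>r\<close> with \<open>x ^ 2 ^ r = y\<close>. Among the \<open>n\<close>-th roots of unity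
  the word can thus be nonzero only at conjugates of \<open>x\<close>.\<close>

lemma ev_trace_word:
  assumes "x ^ n = 1" "y ^ n = 1"
  shows "ev (trace_word a (inverse x)) y = (\<Sum>r\<in>{r. r < m \<and> x ^ 2 ^ r = y}. a ^ 2 ^ r)"
proof -
  have [simp]: "x \<noteq> 0" using assms n_pos by (metis power_0_left zero_neq_one less_numeral_extra(3))
  have "ev (trace_word a (inverse x)) y = (\<Sum>i<n. tr (a * inverse x ^ i) * y ^ i)"
    by (subst ev_eq_sum[OF degree_trace_word]) (simp add: coeff_trace_word)
  also have "\<dots> = (\<Sum>i<n. \<Sum>r<m. a ^ 2 ^ r * (y / x ^ 2 ^ r) ^ i)"
    unfolding tr_def sum_distrib_right
    by (intro sum.cong refl)
      (simp add: power_mult_distrib power_divide divide_simps power_mult[symmetric] mult.commute)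
  also have "\<dots> = (\<Sum>r<m. a ^ 2 ^ r * (\<Sum>i<n. (y / x ^ 2 ^ r) ^ i))"
    by (subst sum.swap) (simp add: sum_distrib_left)
  also have "\<dots> = (\<Sum>r<m. a ^ 2 ^ r * (if x ^ 2 ^ r = y then 1 else 0))"
  proof (intro sum.cong refl)
    fix r
    have "(y / x ^ 2 ^ r) ^ n = y ^ n / (x ^ n) ^ 2 ^ r"
      by (simp add: power_divide power_mult[symmetric] mult.commute)
    then have "(y / x ^ 2 ^ r) ^ n = 1" by (simp add: assms)
    moreover have "y / x ^ 2 ^ r = 1 \<longleftrightarrow> x ^ 2 ^ r = y"
      by (auto simp: divide_simps)
    ultimately show "a ^ 2 ^ r * (\<Sum>i<n. (y / x ^ 2 ^ r) ^ i)
        = a ^ 2 ^ r * (if x ^ 2 ^ r = y then 1 else 0)"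
      by (simp add: sum_powers_root_of_unity)
  qed
  also have "\<dots> = (\<Sum>r\<in>{r. r < m \<and> x ^ 2 ^ r = y}. a ^ 2 ^ r)"
    by (intro sum.mono_neutral_cong_right) auto
  finally show ?thesis .
qed

definition conjugate_closed :: "'a set \<Rightarrow> bool" where
  "conjugate_closed Z \<longleftrightarrow> (\<forall>x\<in>Z. x ^ n = 1 \<and> (\<forall>r. x ^ 2 ^ r \<in> Z))"

text \<open>A closed set missing \<open>x\<close> misses all its conjugates, since further Frobenius
  powers lead from each of them back to \<open>x\<close>.\<close>

lemma trace_word_mem:
  assumes "conjugate_closed Z" "x ^ n = 1" "x \<notin> Z"
  shows "trace_word a (inverse x) \<in> code_with_zeros Z"
  unfolding code_with_zeros_def
proof (safe intro!: degree_trace_word)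
  fix y assume y: "y \<in> Z"
  have "{r. r < m \<and> x ^ 2 ^ r = y} = {}"
  proof safe
    fix r assume r: "r < m" "y = x ^ 2 ^ r"
    then have "y ^ 2 ^ (m - r) = x"
      by (simp add: power_mult[symmetric] power_add[symmetric])
    then show "r \<in> {}" using y assms by (metis conjugate_closed_def)
  qed
  moreover have "y ^ n = 1" using y assms(1) by (simp add: conjugate_closed_def)
  ultimately show "ev (trace_word a (inverse x)) y = 0"
    using assms(2) by (simp only: ev_trace_word sum.empty)
qed

text \<open>If \<open>x\<close> lies in one set only, a trace word for \<open>x\<close> belongs to
  the code of the other set, and a suitable \<open>a\<close> makes it nonzero at
  \<open>x\<close>.\<close>

lemma code_with_zeros_inject:
  assumes "conjugate_closed Z" "conjugate_closed Z'"
    and "code_with_zeros Z = code_with_zeros Z'"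
  shows "Z = Z'"
proof -
  have "Y \<subseteq> Y'" if "conjugate_closed Y" "conjugate_closed Y'"
    "code_with_zeros Y = code_with_zeros Y'" for Y Y'
  proof (rule subsetI, rule ccontr)
    fix x assume x: "x \<in> Y" "x \<notin> Y'"
    then have xn: "x ^ n = 1" using that(1) by (auto simp: conjugate_closed_def)
    let ?R = "{r. r < m \<and> x ^ 2 ^ r = x}"
    obtain a :: 'a where "(\<Sum>r\<in>?R. a ^ 2 ^ r) \<noteq> 0"
      using nonconstant_linearized_poly_nonzero[OF card, of ?R] m_pos by auto
    then have "ev (trace_word a (inverse x)) x \<noteq> 0"
      by (simp add: ev_trace_word xn)
    moreover have "trace_word a (inverse x) \<in> code_with_zeros Y"
      using trace_word_mem that(2,3) xn x(2) by blast
    ultimately show False using x(1) by (auto simp: code_with_zeros_def)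
  qed
  then show ?thesis using assms by blast
qed

text \<open>Parseval's identity: orthogonality of the powers of \<beta> reduces the triple sum to
  its diagonal.\<close>

lemma inner_product_eq:
  assumes "degree u < n" "degree v < n"
  shows "F2 (\<Sum>i<n. coeff u i * coeff v i) = (\<Sum>t<n. ev u (\<beta> ^ t) * ev v (inverse (\<beta> ^ t)))"
proof -
  let ?u = "\<lambda>i. F2 (coeff u i)" and ?v = "\<lambda>i. F2 (coeff v i)"
  have "(\<Sum>t<n. ev u (\<beta> ^ t) * ev v (inverse (\<beta> ^ t)))
      = (\<Sum>t<n. \<Sum>i<n. \<Sum>k<n. ?u i * ?v k * (\<beta> ^ i / \<beta> ^ k) ^ t)"
    by (simp add: ev_eq_sum assms sum_product power_divide divide_simps power_mult[symmetric]
        algebra_simps)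
  also have "\<dots> = (\<Sum>i<n. \<Sum>t<n. \<Sum>k<n. ?u i * ?v k * (\<beta> ^ i / \<beta> ^ k) ^ t)"
    by (rule sum.swap)
  also have "\<dots> = (\<Sum>i<n. \<Sum>k<n. ?u i * ?v k * (\<Sum>t<n. (\<beta> ^ i / \<beta> ^ k) ^ t))"
    by (subst sum.swap) (simp add: sum_distrib_left)
  also have "\<dots> = (\<Sum>i<n. \<Sum>k<n. if k = i then ?u i * ?v k else 0)"
  proof (intro sum.cong refl)
    fix i k assume ik: "i \<in> {..<n}" "k \<in> {..<n}"
    have "(\<beta> ^ i / \<beta> ^ k) ^ n = (\<beta> ^ n) ^ i / (\<beta> ^ n) ^ k"
      by (simp only: power_divide power_mult[symmetric] mult.commute)
    moreover have "\<beta> ^ i / \<beta> ^ k = 1 \<longleftrightarrow> k = i"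
      using power_eq_iff_cong[of i k] ik by (auto simp: cong_def)
    ultimately show "?u i * ?v k * (\<Sum>t<n. (\<beta> ^ i / \<beta> ^ k) ^ t) = (if k = i then ?u i * ?v k else 0)"
      by (simp add: sum_powers_root_of_unity)
  qed
  also have "\<dots> = F2 (\<Sum>i<n. coeff u i * coeff v i)"
    by (simp add: F2_sum F2_mult sum.delta)
  finally show ?thesis ..
qed

text \<open>If \<open>u\<close> has the stated zeros, every summand in Parseval's identity vanishes.
  Conversely, the inner product of \<open>u\<close> with a trace word is
  \<open>tr (a * ev u x)\<close>, which detects a nonzero value of \<open>u\<close> at
  \<open>x\<close>.\<close>

lemma dual_code_with_zeros:
  assumes Z: "conjugate_closed Z"
  shows "dual_code n (code_with_zeros Z) = code_with_zeros {\<beta> ^ t | t. inverse (\<beta> ^ t) \<notin> Z}"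
    (is "_ = code_with_zeros ?D")
proof (intro equalityI subsetI)
  fix u assume u: "u \<in> code_with_zeros ?D"
  then have du: "degree u < n" by (simp add: code_with_zeros_def)
  show "u \<in> dual_code n (code_with_zeros Z)"
    unfolding dual_code_def
  proof (safe intro!: du)
    fix v assume v: "v \<in> code_with_zeros Z"
    then have dv: "degree v < n" by (simp add: code_with_zeros_def)
    have "ev u (\<beta> ^ t) * ev v (inverse (\<beta> ^ t)) = 0" for t
    proof (cases "inverse (\<beta> ^ t) \<in> Z")
      case False
      then have "\<beta> ^ t \<in> ?D" by blast
      then show ?thesis using u unfolding code_with_zeros_def by simp
    qed (use v in \<open>auto simp: code_with_zeros_def\<close>)
    then have "F2 (\<Sum>i<n. coeff u i * coeff v i) = 0"
      unfolding inner_product_eq[OF du dv] by (simp only: sum.neutral_const)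
    then show "(\<Sum>i<n. coeff u i * coeff v i) = 0" by (simp only: F2_simps)
  qed
next
  fix u assume "u \<in> dual_code n (code_with_zeros Z)"
  then have du: "degree u < n"
    and orth: "\<And>v. v \<in> code_with_zeros Z \<Longrightarrow> (\<Sum>i<n. coeff u i * coeff v i) = 0"
    by (auto simp: dual_code_def)
  have "ev u x = 0" if "x ^ n = 1" "inverse x \<notin> Z" for x
  proof (rule ccontr)
    assume nz: "ev u x \<noteq> 0"
    obtain c :: 'a where c: "tr c \<noteq> 0"
      using nonconstant_linearized_poly_nonzero[OF card, of "{..<m}"] m_pos
      unfolding tr_def by auto
    \<comment> \<open>Chosen so that \<open>a * ev u x\<close> is \<open>c\<close>, an element of
      nonzero trace.\<close>
    define a where "a = c / ev u x"
    have "inverse x ^ n = 1" using that(1) by (simp add: power_inverse)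
    then have "trace_word a (inverse (inverse x)) \<in> code_with_zeros Z"
      using Z that(2) by (intro trace_word_mem)
    then have "0 = F2 (\<Sum>i<n. coeff u i * coeff (trace_word a x) i)"
      by (simp add: orth)
    also have "\<dots> = (\<Sum>i<n. F2 (coeff u i) * tr (a * x ^ i))"
      by (simp add: F2_sum F2_mult coeff_trace_word)
    also have "\<dots> = tr (a * ev u x)"
      by (simp add: ev_eq_sum du tr_sum sum_distrib_left mult.left_commute flip: tr_F2)
    also have "\<dots> = tr c" using nz by (simp add: a_def)
    finally show False using c by simp
  qed
  then show "u \<in> code_with_zeros ?D" using du power_root by (auto simp: code_with_zeros_def)
qed

section \<open>BCH codes and their duals in terms of exponents\<close>

definition conjugates :: "nat set \<Rightarrow> 'a set" where
  "conjugates J = {\<beta> ^ t | t. t \<in> coset_union n J}"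

lemma power_mem_conjugates_iff: "\<beta> ^ t \<in> conjugates J \<longleftrightarrow> t \<in> coset_union n J"
  unfolding conjugates_def coset_union_def mem_Collect_eq power_eq_iff_cong
  by (meson cong_sym cong_trans cong_refl)

lemma conjugate_closed_conjugates: "conjugate_closed (conjugates J)"
  unfolding conjugate_closed_def
proof (intro ballI conjI allI)
  fix x r assume "x \<in> conjugates J"
  then obtain t j i where x: "x = \<beta> ^ t" "j \<in> J" "[t = 2 ^ i * j] (mod n)"
    unfolding conjugates_def coset_union_def by blast
  show "x ^ n = 1" by (simp add: x power_root)
  have "[t * 2 ^ r = 2 ^ i * j * 2 ^ r] (mod n)" using x(3) cong_scalar_right by blast
  then have "[t * 2 ^ r = 2 ^ (i + r) * j] (mod n)" by (simp add: power_add ac_simps)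
  then have "\<beta> ^ (t * 2 ^ r) \<in> conjugates J"
    using x(2) by (simp only: power_mem_conjugates_iff mem_coset_unionI)
  then show "x ^ 2 ^ r \<in> conjugates J" by (simp add: x power_mult)
qed

text \<open>Replacing the zeros by their closure under squaring does not change the code and makes
  the zero set recoverable from it.\<close>

lemma bch_code_eq_conjugates: "bch_code \<beta> n d b = code_with_zeros (conjugates {b..b + d - 2})"
proof -
  have "(\<forall>x\<in>conjugates J. ev v x = 0) \<longleftrightarrow> (\<forall>j\<in>J. ev v (\<beta> ^ j) = 0)" for v J
  proof (intro iffI ballI)
    fix j assume "\<forall>x\<in>conjugates J. ev v x = 0" "j \<in> J"
    moreover from this have "\<beta> ^ j \<in> conjugates J"
      unfolding power_mem_conjugates_iff by (intro mem_coset_unionI[of j _ _ 0]) auto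
    ultimately show "ev v (\<beta> ^ j) = 0" by blast
  next
    fix x assume v: "\<forall>j\<in>J. ev v (\<beta> ^ j) = 0" and "x \<in> conjugates J"
    then obtain t j i where x: "x = \<beta> ^ t" "j \<in> J" "[t = 2 ^ i * j] (mod n)"
      unfolding conjugates_def coset_union_def by blast
    then have "x = \<beta> ^ (2 ^ i * j)" by (simp only: power_eq_iff_cong)
    then have "x = (\<beta> ^ j) ^ 2 ^ i" by (simp only: power_mult mult.commute)
    then show "ev v x = 0" using v x(2) by (simp add: ev_power_two zero_power)
  qed
  then show ?thesis by (simp add: bch_code_eq code_with_zeros_def)
qed

text \<open>Both codes have conjugate-closed zero sets, so they agree exactly if these sets do. The
  range \<open>t \<le> n\<close> covers all residues and makes \<open>n - t\<close> the true
  negative of \<open>t\<close>.\<close>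

lemma dual_bch_code_eq_iff:
  "dual_code n (bch_code \<beta> n d b) = bch_code \<beta> n d' b' \<longleftrightarrow>
    (\<forall>t\<le>n. t \<in> coset_union n {b'..b' + d' - 2} \<longleftrightarrow> n - t \<notin> coset_union n {b..b + d - 2})"
    (is "_ \<longleftrightarrow> (\<forall>t\<le>n. t \<in> coset_union n ?J' \<longleftrightarrow> n - t \<notin> coset_union n ?J)")
proof -
  let ?Z = "conjugates ?J" and ?Z' = "conjugates ?J'"
  let ?D = "{\<beta> ^ t | t. inverse (\<beta> ^ t) \<notin> ?Z}"
  have closed: "conjugate_closed ?D"
    unfolding conjugate_closed_def
  proof (intro ballI conjI allI)
    fix x r assume "x \<in> ?D"
    then obtain t where t: "x = \<beta> ^ t" "inverse x \<notin> ?Z" by blast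
    show "x ^ n = 1" by (simp add: t(1) power_root)
    have "inverse (x ^ 2 ^ r) \<notin> ?Z"
    proof
      assume "inverse (x ^ 2 ^ r) \<in> ?Z"
      \<comment> \<open>The exponent completes \<open>r\<close> to the multiple \<open>m * r\<close>
        of \<open>m\<close>, so that this power is \<open>inverse x\<close>.\<close>
      then have "inverse (x ^ 2 ^ r) ^ 2 ^ (m * r - r) \<in> ?Z"
        using conjugate_closed_conjugates[of ?J] unfolding conjugate_closed_def by blast
      moreover have "r + (m * r - r) = m * r" using m_pos by simp
      then have "inverse (x ^ 2 ^ r) ^ 2 ^ (m * r - r) = inverse x ^ 2 ^ (m * r)"
        by (simp only: power_inverse[symmetric] power_mult[symmetric] power_add[symmetric])
      moreover have "y ^ 2 ^ (m * r) = y" for y :: 'a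
        by (induction r) (simp_all add: power_add power_mult)
      ultimately show False using t(2) by simp
    qed
    moreover have "x ^ 2 ^ r = \<beta> ^ (t * 2 ^ r)" by (simp add: t(1) power_mult)
    ultimately show "x ^ 2 ^ r \<in> ?D" by auto
  qed
  have "code_with_zeros ?D = code_with_zeros ?Z' \<longleftrightarrow> ?D = ?Z'"
    by (rule iffI, erule code_with_zeros_inject[OF closed conjugate_closed_conjugates], erule arg_cong)
  then have "dual_code n (bch_code \<beta> n d b) = bch_code \<beta> n d' b' \<longleftrightarrow> ?D = ?Z'"
    by (simp only: bch_code_eq_conjugates dual_code_with_zeros[OF conjugate_closed_conjugates])
  also have "\<dots> \<longleftrightarrow> (\<forall>t. \<beta> ^ t \<in> ?Z' \<longleftrightarrow> inverse (\<beta> ^ t) \<notin> ?Z)"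
  proof
    assume "?D = ?Z'"
    moreover have "\<beta> ^ t \<in> ?D \<longleftrightarrow> inverse (\<beta> ^ t) \<notin> ?Z" for t
    proof
      assume "\<beta> ^ t \<in> ?D"
      then obtain t' where "\<beta> ^ t = \<beta> ^ t'" "inverse (\<beta> ^ t') \<notin> ?Z" by blast
      then show "inverse (\<beta> ^ t) \<notin> ?Z" by (simp only: not_False_eq_True)
    qed blast
    ultimately show "\<forall>t. \<beta> ^ t \<in> ?Z' \<longleftrightarrow> inverse (\<beta> ^ t) \<notin> ?Z" by blast
  next
    assume *: "\<forall>t. \<beta> ^ t \<in> ?Z' \<longleftrightarrow> inverse (\<beta> ^ t) \<notin> ?Z"
    show "?D = ?Z'"
    proof (intro equalityI subsetI)
      fix x assume "x \<in> ?D"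
      then show "x \<in> ?Z'" using * by blast
    next
      fix x assume x: "x \<in> ?Z'"
      then obtain t where "x = \<beta> ^ t" by (auto simp: conjugates_def)
      then show "x \<in> ?D" using x * by blast
    qed
  qed
  also have "\<dots> \<longleftrightarrow> (\<forall>t\<le>n. \<beta> ^ t \<in> ?Z' \<longleftrightarrow> inverse (\<beta> ^ t) \<notin> ?Z)"
  proof -
    have reduce: "(\<forall>t\<le>n. P (\<beta> ^ t)) \<longleftrightarrow> (\<forall>t. P (\<beta> ^ t))" for P
    proof (intro iffI allI)
      fix t assume "\<forall>t\<le>n. P (\<beta> ^ t)"
      moreover have "t mod n \<le> n" using n_pos by (simp add: less_imp_le)
      ultimately have "P (\<beta> ^ (t mod n))" by blast
      moreover have "\<beta> ^ (t mod n) = \<beta> ^ t" unfolding power_eq_iff_cong by simp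
      ultimately show "P (\<beta> ^ t)" by simp
    qed blast
    show ?thesis by (rule reduce[symmetric])
  qed
  also have "\<dots> \<longleftrightarrow> (\<forall>t\<le>n. t \<in> coset_union n ?J' \<longleftrightarrow> n - t \<notin> coset_union n ?J)"
    by (simp add: inverse_power power_mem_conjugates_iff)
  finally show ?thesis .
qed

end

section \<open>The order of a generator and the characterization of dually-BCH codes\<close>

lemma generates_units_power_eq_1_iff:
  fixes \<alpha> :: "'a :: {field, finite}"
  assumes "generates_units \<alpha>"
  shows "\<alpha> ^ k = 1 \<longleftrightarrow> CARD('a) - 1 dvd k"
proof -
  let ?N = "CARD('a) - 1"
  have r: "range (\<lambda>k. \<alpha> ^ k) = UNIV - {0}" using assms by (simp add: generates_units_def)
  then have nz: "\<alpha> \<noteq> 0" by (metis Diff_iff insertI1 power_one_right rangeI)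
  have "\<alpha> * \<alpha> ^ ?N = \<alpha> * 1"
    using finite_field_power_card[of \<alpha>] by (simp flip: power_Suc)
  then have 1: "\<alpha> ^ ?N = 1" using nz by simp
  have "CARD('a) \<noteq> 1" by (metis (full_types) UNIV_I card_1_singletonE singletonD zero_neq_one)
  then have N: "?N > 0" using zero_less_card_finite[where 'a = 'a] by linarith
  have mod: "\<alpha> ^ k = \<alpha> ^ (k mod l)" if "\<alpha> ^ l = 1" for k l
  proof -
    have "\<alpha> ^ k = \<alpha> ^ (l * (k div l) + k mod l)" by simp
    also have "\<dots> = \<alpha> ^ (k mod l)" by (simp only: power_add power_mult that power_one mult_1)
    finally show ?thesis .
  qed
  \<comment> \<open>If \<open>\<alpha> ^ l = 1\<close>, the first \<open>l\<close> powers already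
    exhaust all units.\<close>
  have least: "?N \<le> l" if "\<alpha> ^ l = 1" "l > 0" for l
  proof -
    have "\<alpha> ^ k \<in> (\<lambda>k. \<alpha> ^ k) ` {..<l}" for k
      using mod[OF that(1), of k] that(2) by (intro image_eqI[of _ _ "k mod l"]) auto
    then have "UNIV - {0} \<subseteq> (\<lambda>k. \<alpha> ^ k) ` {..<l}" unfolding r[symmetric] by blast
    then have "card (UNIV - {0 :: 'a}) \<le> card ((\<lambda>k. \<alpha> ^ k) ` {..<l})" by (intro card_mono) auto
    also have "\<dots> \<le> l" using card_image_le[of "{..<l}"] by simp
    finally show ?thesis by (simp add: card_Diff_singleton)
  qed
  show ?thesis
  proof
    assume "\<alpha> ^ k = 1"
    then have "\<alpha> ^ (k mod ?N) = 1" using mod[OF 1, of k] by simp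
    then have "k mod ?N = 0" using least[of "k mod ?N"] N mod_less_divisor[of ?N k] by linarith
    then show "?N dvd k" by blast
  next
    assume "?N dvd k"
    then show "\<alpha> ^ k = 1" using mod[OF 1, of k] by simp
  qed
qed

theorem theorem29:
  fixes \<alpha> \<beta>\<^sub>1 :: "'a :: {field, finite}" and s n \<delta> :: nat
  assumes "s \<ge> 2" and "even s"
    and "CARD('a) = 2 ^ (2 * s)"
    and "generates_units \<alpha>"
    and "\<beta>\<^sub>1 = \<alpha> ^ 3"
    and "n = (2 ^ (2 * s) - 1) div 3"
    and "2 \<le> \<delta>" and "\<delta> \<le> n"
  shows "dually_bch \<beta>\<^sub>1 n (bch_code \<beta>\<^sub>1 n \<delta> 2) \<longleftrightarrow>
    largest_coset_leader n \<le> \<delta> \<and> \<delta> \<le> n - 1"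
proof -
  \<comment> \<open>The division by 3 in \<open>n\<close> is exact; then \<alpha> has order
    \<open>3 * n\<close> and its cube has order \<open>n\<close>.\<close>
  have "[4 ^ s = 1] (mod (3::nat))" using cong_pow[of 4 1 "3::nat" s] by (simp add: cong_def)
  then have "(2::nat) ^ (2 * s) mod 3 = 1" by (simp add: cong_def power_mult)
  then have n: "3 * n + 1 = 2 ^ (2 * s)" using assms(6) by presburger
  then have n_pos: "n > 0" using power_increasing[of 4 "2 * s" "2::nat"] assms(1) by simp
  have "2 ^ (2 * s) - 1 = 3 * n" using n by simp
  then interpret primitive_root_char_2 \<beta>\<^sub>1 n "2 * s"
    using assms(3) n_pos generates_units_power_eq_1_iff[OF assms(4)]
    by unfold_locales (simp_all add: assms(5) flip: power_mult)
  have m: "[2 ^ (2 * s) = 1] (mod n)" "2 * s > 0"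
    using assms(1) unfolding n[symmetric] cong_def by (simp_all only: mod_mult_self3)
  have from_1: "coset_union n {2..\<delta>} = coset_union n {1..\<delta>}"
    by (rule coset_union_from_1[OF m assms(7)])
  have "is_bch_code \<beta>\<^sub>1 n (bch_code \<beta>\<^sub>1 n \<delta> 2)"
    unfolding is_bch_code_def using assms(7,8) by (intro exI[of _ \<delta>] exI[of _ 2]) auto
  then have "dually_bch \<beta>\<^sub>1 n (bch_code \<beta>\<^sub>1 n \<delta> 2) \<longleftrightarrow>
      (\<exists>d b. 1 \<le> b \<and> 2 \<le> d \<and> d \<le> n \<and>
        (\<forall>t\<le>n. t \<in> coset_union n {b..b + d - 2} \<longleftrightarrow> n - t \<notin> coset_union n {2..\<delta>}))"
    by (simp add: dually_bch_def is_bch_code_def dual_bch_code_eq_iff)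
  also have "\<dots> \<longleftrightarrow> largest_coset_leader n \<le> \<delta> \<and> \<delta> \<le> n - 1"
  proof (intro iffI conjI)
    assume "\<exists>d b. 1 \<le> b \<and> 2 \<le> d \<and> d \<le> n \<and>
      (\<forall>t\<le>n. t \<in> coset_union n {b..b + d - 2} \<longleftrightarrow> n - t \<notin> coset_union n {2..\<delta>})"
    then obtain d b where b: "1 \<le> b" "2 \<le> d" and
      compl: "\<And>t. t \<le> n \<Longrightarrow> t \<in> coset_union n {b..b + d - 2} \<longleftrightarrow> n - t \<notin> coset_union n {2..\<delta>}"
      by blast
    show \<delta>: "\<delta> \<le> n - 1"
    proof (rule ccontr)
      assume "\<not> \<delta> \<le> n - 1"
      then have "\<delta> = n" using assms(8) by simp
      \<comment> \<open>For \<delta> = \<open>n\<close> the interval from 1 meets every residue,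
        here the negative of \<open>b\<close>, although \<open>b\<close> is the exponent of a zero
        of the dual.\<close>
      then have "n - b mod n \<in> coset_union n {2..\<delta>}"
        unfolding from_1 using mod_less_divisor[OF n_pos, of b] by (intro mem_coset_unionI[of "n - b mod n" _ _ 0]) auto
      moreover have "b mod n \<in> coset_union n {b..b + d - 2}"
        using b(2) by (intro mem_coset_unionI[of b _ _ 0]) auto
      ultimately show False using compl[of "b mod n"] n_pos by (simp add: less_imp_le)
    qed
    show "largest_coset_leader n \<le> \<delta>"
    proof (rule ccontr)
      assume "\<not> largest_coset_leader n \<le> \<delta>"
      then obtain \<tau> u where "0 < \<tau>" "\<tau> < n" "\<tau> \<in> coset_union n {2..\<delta>}" "u < n"
        "\<And>i. \<delta> < 2 ^ i * u mod n \<and> 2 ^ i * u mod n \<le> \<tau>"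
        using separating_coset[OF assms(2,1) n assms(7)] by (metis not_le)
      moreover have "\<delta> < n" using \<delta> n_pos by simp
      ultimately show False using no_interval[OF m assms(7) _ b(1) compl] by blast
    qed
  next
    assume *: "largest_coset_leader n \<le> \<delta> \<and> \<delta> \<le> n - 1"
    then have \<delta>: "\<delta> < n" using n_pos by linarith
    \<comment> \<open>The dual has the single zero 1. As offsets start at 1, its exponent is written
      as \<open>n\<close>, giving offset \<open>n\<close> and designed distance 2.\<close>
    have "t \<in> coset_union n {n} \<longleftrightarrow> n - t \<notin> coset_union n {2..\<delta>}" if "t \<le> n" for t
    proof (cases "n dvd t")
      case True
      then have "t \<in> coset_union n {n}"
        by (intro mem_coset_unionI[of n _ _ 0]) (auto simp: cong_def mod_eq_0_iff_dvd)
      moreover have "n dvd n - t" using True by (simp add: dvd_diff_nat)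
      then have "n - t \<notin> coset_union n {2..\<delta>}"
        using \<delta> by (intro multiple_notin_coset_union[OF m]) auto
      ultimately show ?thesis by blast
    next
      case False
      then have "t \<notin> coset_union n {n}"
        by (auto simp: coset_union_def cong_def mod_eq_0_iff_dvd)
      moreover have "n - t \<in> coset_union n {2..\<delta>}"
      proof -
        have "t \<noteq> 0" using False by (metis dvd_0_right)
        then have "n - t < n" using n_pos that by linarith
        then obtain i where i: "2 ^ i * (n - t) mod n \<le> \<delta>"
          using * largest_coset_leader_le_iff[OF n_pos] by blast
        define w where "w = 2 ^ i * (n - t) mod n"
        have "[w = 2 ^ i * (n - t)] (mod n)" by (simp add: w_def)
        then obtain i' where i': "[2 ^ i' * w = n - t] (mod n)" by (rule coset_sym[OF m])
        \<comment> \<open>The bound on the leader would also admit 0, which is not in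
          \<open>{1..\<delta>}\<close>.\<close>
        have "w \<noteq> 0"
        proof
          assume "w = 0"
          then have "n dvd n - t" using i' by (simp add: cong_def mod_eq_0_iff_dvd)
          moreover have "t \<noteq> n" using False by auto
          then have "n - t > 0" using that by simp
          ultimately have "n \<le> n - t" by (rule dvd_imp_le)
          then show False using \<open>n - t < n\<close> by simp
        qed
        then have "w \<in> {1..\<delta>}" using i by (simp add: w_def)
        then show ?thesis unfolding from_1 using i' cong_sym by (blast intro: mem_coset_unionI)
      qed
      ultimately show ?thesis by blast
    qed
    then show "\<exists>d b. 1 \<le> b \<and> 2 \<le> d \<and> d \<le> n \<and>
        (\<forall>t\<le>n. t \<in> coset_union n {b..b + d - 2} \<longleftrightarrow> n - t \<notin> coset_union n {2..\<delta>})"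
      using \<delta> assms(7) n_pos by (intro exI[of _ 2] exI[of _ n]) auto
  qed
  finally show ?thesis .
qed

end
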